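(* Let $N=\{1,\ldots,n\}$ and let $G:[-1,1]^n\to[-1,1]$ be an aggregation function. Then $G$ is idempotent, bipolar comonotone maxitive and homogeneous if and only if there exists a bi-capacity $\mu_b$ on $N$ such that, for all $x\in[-1,1]^n$, $$G(x)=Sh_b(x,\mu_b),$$ where $Sh_b(x,\mu_b)$ is the bipolar Shilkret integral of $x$ with respect to $\mu_b$.
   Context: Aggregation function: $G:[-1,1]^n\to[-1,1]$ with $G(-1,\ldots,-1)=-1$, $G(1,\ldots,1)=1$, and $G(x)\ge G(y)$ whenever $x_i\ge y_i$ for all $i\in N$. Idempotent: $G(a,\ldots,a)=a$ for all $a\in[-1,1]$. Homogeneous: $G(c\,x)=c\,G(x)$ for all $x\in[-1,1]^n$ and $c>0$ such that $c\,x\in[-1,1]^n$. $\mathcal Q=\{(A,B)\in 2^N\times 2^N: A\cap B=\emptyset\}$. Write $(A,B)\precsim(C,D)$ if $A\subseteq C$ and $B\supseteq D$; write $(A,B)\subseteq(C,D)$ if $A\subseteq C$ and $B\subseteq D$. For $(A,B)\in\mathcal Q$, $\mathbf 1_{(A,B)}\in\{-1,0,1\}^n$ is the vector with $i$-th component $1$ if $i\in A$, $-1$ if $i\in B$, and $0$ otherwise. Bi-capacity on $N$: a function $\mu_b:\mathcal Q\to[-1,1]$ with $\mu_b(\emptyset,\emptyset)=0$, $\mu_b(N,\emptyset)=1$, $\mu_b(\emptyset,N)=-1$, and $\mu_b(A,B)\le\mu_b(C,D)$ whenever $(A,B)\precsim(C,D)$. Bipolar maximum: for $X=\{x_1,\ldots,x_m\}\subseteq\mathbb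 R$, if there is $x_k\in X$ with $|x_k|>|x_j|$ for all $j$ with $x_j\ne x_k$, then $\bigvee^b X=x_k$; otherwise $\bigvee^b X=0$. For vectors, $\bigvee^b$ is taken componentwise. Bipolar comonotone maxitive: for every $k\ge1$, with $K=\{1,\ldots,k\}$, all levels $0<l_1<l_2<\cdots<l_k\le1$ and all $(A_1,B_1),\ldots,(A_k,B_k)\in\mathcal Q$ with $(A_{i+1},B_{i+1})\subseteq(A_i,B_i)$ for $i=1,\ldots,k-1$, $$G\Big(\bigvee_{i\in K}{}^{b}\; l_i\mathbf 1_{(A_i,B_i)}\Big)=\bigvee_{i\in K}{}^{b}\; G\big(l_i\mathbf 1_{(A_i,B_i)}\big).$$ Bipolar Shilkret integral of $x\in[-1,1]^n$ with respect to $\mu_b$: $$Sh_b(x,\mu_b)=\bigvee_{i\in N}{}^{b}\;\big\{|x_i|\cdot\mu_b(\{j\in N:x_j\ge|x_i|\},\{j\in N:x_j\le-|x_i|\})\big\},$$ with the convention that when $x_i=0$ the inequality $x_j\le-|x_i|$ is read as $x_j<0$ (so that the pair lies in $\mathcal Q$). *)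

theory Defs
  imports "HOL-Analysis.Analysis"
begin

text \<open>The index set \<open>N = {1, ..., n}\<close> is the universe of the finite type \<open>'n\<close>.
  Functions on \<open>[-1,1]\<^sup>n\<close> and on the set of disjoint pairs are total functions
  of which only the values on the respective domain are ever constrained or used.\<close>

definition bipolar_cube :: "(real ^ 'n) set" where
  "bipolar_cube = {x. \<forall>i. - 1 \<le> x $ i \<and> x $ i \<le> 1}"

definition aggregation_function :: "(real ^ 'n \<Rightarrow> real) \<Rightarrow> bool" where
  "aggregation_function G \<longleftrightarrow>
     (\<forall>x \<in> bipolar_cube. G x \<in> {-1..1}) \<and>
     G (vec (- 1)) = - 1 \<and> G (vec 1) = 1 \<and>
     (\<forall>x \<in> bipolar_cube. \<forall>y \<in> bipolar_cube. (\<forall>i. x $ i \<ge> y $ i) \<longrightarrow> G x \<ge> G y)"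

definition idempotent :: "(real ^ 'n \<Rightarrow> real) \<Rightarrow> bool" where
  "idempotent G \<longleftrightarrow> (\<forall>a \<in> {-1..1}. G (vec a) = a)"

definition homogeneous :: "(real ^ 'n \<Rightarrow> real) \<Rightarrow> bool" where
  "homogeneous G \<longleftrightarrow>
     (\<forall>x \<in> bipolar_cube. \<forall>c > 0. c *\<^sub>R x \<in> bipolar_cube \<longrightarrow> G (c *\<^sub>R x) = c * G x)"

definition disjoint_pairs :: "('n set \<times> 'n set) set" where
  "disjoint_pairs = {(A, B). A \<inter> B = {}}"

definition bipolar_le :: "'n set \<times> 'n set \<Rightarrow> 'n set \<times> 'n set \<Rightarrow> bool" where
  "bipolar_le P R \<longleftrightarrow> fst P \<subseteq> fst R \<and> snd P \<supseteq> snd R"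

definition pair_subset :: "'n set \<times> 'n set \<Rightarrow> 'n set \<times> 'n set \<Rightarrow> bool" where
  "pair_subset P R \<longleftrightarrow> fst P \<subseteq> fst R \<and> snd P \<subseteq> snd R"

definition bipolar_indicator :: "'n set \<times> 'n set \<Rightarrow> real ^ 'n" where
  "bipolar_indicator P = (\<chi> i. if i \<in> fst P then 1 else if i \<in> snd P then - 1 else 0)"

definition bi_capacity :: "('n set \<times> 'n set \<Rightarrow> real) \<Rightarrow> bool" where
  "bi_capacity \<mu> \<longleftrightarrow>
     (\<forall>P \<in> disjoint_pairs. \<mu> P \<in> {-1..1}) \<and>
     \<mu> ({}, {}) = 0 \<and> \<mu> (UNIV, {}) = 1 \<and> \<mu> ({}, UNIV) = - 1 \<and>
     (\<forall>P \<in> disjoint_pairs. \<forall>R \<in> disjoint_pairs. bipolar_le P R \<longrightarrow> \<mu> P \<le> \<mu> R)"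

definition strictly_dominant :: "real set \<Rightarrow> real \<Rightarrow> bool" where
  "strictly_dominant X x \<longleftrightarrow> x \<in> X \<and> (\<forall>y \<in> X. y \<noteq> x \<longrightarrow> \<bar>x\<bar> > \<bar>y\<bar>)"

text \<open>A strictly dominant element is unique whenever it exists.\<close>

definition bipolar_max :: "real set \<Rightarrow> real" where
  "bipolar_max X =
     (if \<exists>x. strictly_dominant X x then THE x. strictly_dominant X x else 0)"

definition bipolar_max_vec :: "(real ^ 'n) set \<Rightarrow> real ^ 'n" where
  "bipolar_max_vec V = (\<chi> j. bipolar_max ((\<lambda>v. v $ j) ` V))"

definition bipolar_comonotone_maxitive :: "(real ^ 'n \<Rightarrow> real) \<Rightarrow> bool" where
  "bipolar_comonotone_maxitive G \<longleftrightarrow>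
     (\<forall>(k::nat) (l :: nat \<Rightarrow> real) (P :: nat \<Rightarrow> 'n set \<times> 'n set).
        1 \<le> k \<longrightarrow>
        0 < l 1 \<longrightarrow> (\<forall>i \<in> {1..<k}. l i < l (i + 1)) \<longrightarrow> l k \<le> 1 \<longrightarrow>
        (\<forall>i \<in> {1..k}. P i \<in> disjoint_pairs) \<longrightarrow>
        (\<forall>i \<in> {1..<k}. pair_subset (P (i + 1)) (P i)) \<longrightarrow>
        G (bipolar_max_vec ((\<lambda>i. l i *\<^sub>R bipolar_indicator (P i)) ` {1..k})) =
        bipolar_max ((\<lambda>i. G (l i *\<^sub>R bipolar_indicator (P i))) ` {1..k}))"

text \<open>At level \<open>t = 0\<close> the second inequality is strict, so that the pair is disjoint.\<close>

definition level_pair :: "real ^ 'n \<Rightarrow> real \<Rightarrow> 'n set \<times> 'n set" where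
  "level_pair x t = ({j. x $ j \<ge> t}, {j. if t = 0 then x $ j < 0 else x $ j \<le> - t})"

definition bipolar_shilkret :: "real ^ 'n \<Rightarrow> ('n set \<times> 'n set \<Rightarrow> real) \<Rightarrow> real" where
  "bipolar_shilkret x \<mu> = bipolar_max (range (\<lambda>i. \<bar>x $ i\<bar> * \<mu> (level_pair x \<bar>x $ i\<bar>)))"

end

theory Submission
  imports Defs
begin

text \<open>A bipolar maximum does not change when \<open>0\<close> or elements strictly dominated in absolute
  value are added. Hence the bipolar Shilkret integral of \<open>x\<close> may be computed over any set of
  positive levels that contains all the nonzero \<open>\<bar>x\<^sub>i\<bar>\<close>: a superfluous level \<open>t\<close> has the same level pair
  as the least \<open>\<bar>x\<^sub>i\<bar> \<ge> t\<close>, so its term vanishes, is repeated or is dominated.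
  For one direction put \<open>\<mu> P = G 1\<^sub>P\<close> and write \<open>x\<close> as the bipolar maximum of its level vectors;
  for the other, the given levels \<open>l\<^sub>1, \<dots>, l\<^sub>k\<close> are admissible levels for the bipolar maximum of
  the vectors \<open>l\<^sub>i 1\<^sub>P\<^sub>i\<close>, whose level pair at \<open>l\<^sub>i\<close> is \<open>P\<^sub>i\<close>.\<close>

section \<open>The bipolar maximum\<close>

lemma strictly_dominant_unique:
  "strictly_dominant X x \<Longrightarrow> strictly_dominant X y \<Longrightarrow> x = y"
  unfolding strictly_dominant_def by (metis less_asym)

lemma bipolar_max_eq:
  assumes "strictly_dominant X x"
  shows "bipolar_max X = x"
  using assms strictly_dominant_unique unfolding bipolar_max_def
  by (metis the_equality)

lemma bipolar_max_eq_0: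
  assumes "\<And>x. x \<noteq> 0 \<Longrightarrow> \<not> strictly_dominant X x"
  shows "bipolar_max X = 0"
proof (cases "\<exists>x. strictly_dominant X x")
  case True
  then obtain x where "strictly_dominant X x" by blast
  with assms bipolar_max_eq show ?thesis by metis
qed (simp add: bipolar_max_def)

lemma bipolar_max_singleton [simp]: "bipolar_max {x} = x"
  by (rule bipolar_max_eq) (simp add: strictly_dominant_def)

text \<open>Only nonzero dominant elements have to be compared: 0 is strictly dominant only in
  \<open>{0}\<close>, and the maximum is then 0, which is also the default value when nothing
  dominates.\<close>

lemma bipolar_max_cong_dominant:
  assumes "\<And>x. x \<noteq> 0 \<Longrightarrow> strictly_dominant X x \<longleftrightarrow> strictly_dominant Y x"
  shows "bipolar_max X = bipolar_max Y"
proof (cases "\<exists>x. x \<noteq> 0 \<and> strictly_dominant X x")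
  case True
  then show ?thesis using assms bipolar_max_eq by metis
next
  case False
  then show ?thesis using assms bipolar_max_eq_0 by metis
qed

text \<open>A nonzero \<open>t \<noteq> x\<close> in \<open>T\<close> either lies in
  \<open>S\<close> or is beaten by an element of \<open>S\<close>; in both cases its absolute value
  is below that of \<open>x\<close>. Hence no element of \<open>T\<close> can beat \<open>x\<close>,
  and \<open>ST\<close> leaves only \<open>x \<in> T\<close>.\<close>

lemma strictly_dominant_transfer:
  assumes ST: "\<And>s. s \<in> S \<Longrightarrow> s \<noteq> 0 \<Longrightarrow> \<exists>t\<in>T. t = s \<or> \<bar>s\<bar> < \<bar>t\<bar>"
    and TS: "\<And>t. t \<in> T \<Longrightarrow> t \<noteq> 0 \<Longrightarrow> \<exists>s\<in>S. s = t \<or> \<bar>t\<bar> < \<bar>s\<bar>"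
    and x: "x \<noteq> 0" "strictly_dominant S x"
  shows "strictly_dominant T x"
proof -
  have xS: "x \<in> S" and dom: "\<And>s. s \<in> S \<Longrightarrow> s \<noteq> x \<Longrightarrow> \<bar>s\<bar> < \<bar>x\<bar>"
    using x(2) by (auto simp: strictly_dominant_def)
  have less: "\<bar>t\<bar> < \<bar>x\<bar>" if t: "t \<in> T" "t \<noteq> x" for t
  proof (cases "t = 0")
    case False
    then obtain s where "s \<in> S" "s = t \<or> \<bar>t\<bar> < \<bar>s\<bar>" using TS t by blast
    then show ?thesis using dom[of s] t by (cases "s = x") auto
  qed (use x in simp)
  obtain t where "t \<in> T" "t = x \<or> \<bar>x\<bar> < \<bar>t\<bar>" using ST xS x(1) by blast
  with less[of t] have "x \<in> T" by (cases "t = x") auto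
  with less show ?thesis by (simp add: strictly_dominant_def)
qed

lemma bipolar_max_cong:
  assumes "\<And>s. s \<in> S \<Longrightarrow> s \<noteq> 0 \<Longrightarrow> \<exists>t\<in>T. t = s \<or> \<bar>s\<bar> < \<bar>t\<bar>"
    and "\<And>t. t \<in> T \<Longrightarrow> t \<noteq> 0 \<Longrightarrow> \<exists>s\<in>S. s = t \<or> \<bar>t\<bar> < \<bar>s\<bar>"
  shows "bipolar_max S = bipolar_max T"
proof (intro bipolar_max_cong_dominant iffI)
  fix x :: real assume "x \<noteq> 0" "strictly_dominant S x"
  then show "strictly_dominant T x" using strictly_dominant_transfer[of S T x] assms by blast
next
  fix x :: real assume "x \<noteq> 0" "strictly_dominant T x"
  then show "strictly_dominant S x" using strictly_dominant_transfer[of T S x] assms by blast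
qed

lemma bipolar_max_scale:
  assumes "c > 0"
  shows "bipolar_max ((*) c ` X) = c * bipolar_max X"
proof -
  have iff: "strictly_dominant ((*) c ` X) (c * x) \<longleftrightarrow> strictly_dominant X x" for x
    using assms by (auto simp: strictly_dominant_def abs_mult)
  show ?thesis
  proof (cases "\<exists>x. strictly_dominant X x")
    case True
    then show ?thesis using iff bipolar_max_eq by metis
  next
    case False
    then have "\<not> strictly_dominant ((*) c ` X) y" for y
      using iff[of "y / c"] assms by simp
    with False show ?thesis by (simp add: bipolar_max_def)
  qed
qed

section \<open>Level pairs\<close>

lemma level_pair_disjoint:
  assumes "t \<ge> 0"
  shows "level_pair x t \<in> disjoint_pairs"
  using assms by (auto simp: level_pair_def disjoint_pairs_def)

lemma level_pair_antimono:
  assumes "0 < s" "s \<le> t"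
  shows "pair_subset (level_pair x t) (level_pair x s)"
  using assms by (auto simp: level_pair_def pair_subset_def)

lemma level_pair_scale:
  assumes "c > 0"
  shows "level_pair (c *\<^sub>R x) (c * t) = level_pair x t"
proof -
  have "c * x $ j \<le> - (c * t) \<longleftrightarrow> x $ j \<le> - t" for j
    using assms mult_le_cancel_left_pos[of c "x $ j" "- t"] by simp
  then show ?thesis using assms by (simp add: level_pair_def mult_less_0_iff)
qed

lemma level_pair_indicator:
  assumes "P \<in> disjoint_pairs" "t > 0"
  shows "level_pair (t *\<^sub>R bipolar_indicator P) t = P"
  using assms by (cases P) (auto simp: level_pair_def bipolar_indicator_def disjoint_pairs_def)

text \<open>Choose \<open>j\<close> with the least \<open>\<bar>x $ j\<bar>\<close> among those
  reaching \<open>t\<close>. No component has an absolute value in between, so both thresholds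
  select the same components.\<close>

lemma level_pair_attained:
  fixes x :: "real ^ 'n"
  assumes t: "t > 0" and ne: "level_pair x t \<noteq> ({}, {})"
  obtains j where "\<bar>x $ j\<bar> \<ge> t" "level_pair x \<bar>x $ j\<bar> = level_pair x t"
proof -
  define J where "J = {j. \<bar>x $ j\<bar> \<ge> t}"
  have "J \<noteq> {}"
  proof
    \<comment> \<open>If no component reaches \<open>t\<close> in absolute value, the level pair is
      \<open>({}, {})\<close>, against \<open>ne\<close>.\<close>
    assume "J = {}"
    then have "\<bar>x $ i\<bar> < t" for i by (auto simp: J_def not_le)
    then have "\<not> t \<le> x $ i \<and> \<not> x $ i \<le> - t" for i by (smt (verit))
    then show False using t ne by (simp add: level_pair_def)
  qed
  then have "Min ((\<lambda>j. \<bar>x $ j\<bar>) ` J) \<in> (\<lambda>j. \<bar>x $ j\<bar>) ` J" by (intro Min_in) auto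
  then obtain j where "j \<in> J" "Min ((\<lambda>j. \<bar>x $ j\<bar>) ` J) = \<bar>x $ j\<bar>" by blast
  then have j: "j \<in> J" "\<And>i. i \<in> J \<Longrightarrow> \<bar>x $ j\<bar> \<le> \<bar>x $ i\<bar>"
    by (metis Min_le finite finite_imageI imageI)+
  have ge: "\<bar>x $ j\<bar> \<ge> t" using j(1) by (simp add: J_def)
  have iff: "t \<le> \<bar>x $ i\<bar> \<longleftrightarrow> \<bar>x $ j\<bar> \<le> \<bar>x $ i\<bar>" for i
    using j(2)[of i] ge by (auto simp: J_def)
  have "x $ i \<ge> \<bar>x $ j\<bar> \<longleftrightarrow> x $ i \<ge> t" "x $ i \<le> - \<bar>x $ j\<bar> \<longleftrightarrow> x $ i \<le> - t" for i
    using iff[of i] ge t by linarith+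
  moreover have "\<bar>x $ j\<bar> \<noteq> 0" using ge t by linarith
  ultimately have "level_pair x \<bar>x $ j\<bar> = level_pair x t"
    using t unfolding level_pair_def by auto
  with ge that show ?thesis by blast
qed

section \<open>The bipolar Shilkret integral over an arbitrary set of levels\<close>

lemma bipolar_shilkret_levels:
  assumes \<mu>: "\<mu> ({}, {}) = 0" and pos: "\<And>t. t \<in> L \<Longrightarrow> t > 0"
    and cover: "\<And>j. x $ j \<noteq> 0 \<Longrightarrow> \<bar>x $ j\<bar> \<in> L"
  shows "bipolar_shilkret x \<mu> = bipolar_max ((\<lambda>t. t * \<mu> (level_pair x t)) ` L)"
  unfolding bipolar_shilkret_def
proof (rule bipolar_max_cong)
  fix s assume "s \<in> range (\<lambda>i. \<bar>x $ i\<bar> * \<mu> (level_pair x \<bar>x $ i\<bar>))" "s \<noteq> 0"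
  then show "\<exists>t\<in>(\<lambda>t. t * \<mu> (level_pair x t)) ` L. t = s \<or> \<bar>s\<bar> < \<bar>t\<bar>"
    using cover by fastforce
next
  fix s assume "s \<in> (\<lambda>t. t * \<mu> (level_pair x t)) ` L" "s \<noteq> 0"
  then obtain t where t: "t \<in> L" "s = t * \<mu> (level_pair x t)" and nz: "\<mu> (level_pair x t) \<noteq> 0"
    by auto
  \<comment> \<open>A nonzero term rules out the pair \<open>({}, {})\<close>, on which
    \<open>\<mu>\<close> vanishes, so \<open>t\<close> can be raised to some
    \<open>\<bar>x $ j\<bar>\<close> without changing the pair.\<close>
  then obtain j where j: "\<bar>x $ j\<bar> \<ge> t" "level_pair x \<bar>x $ j\<bar> = level_pair x t"
    using level_pair_attained[of t x] \<mu> pos by metis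
  \<comment> \<open>Both terms contain the same nonzero value of \<open>\<mu>\<close>; if the levels
    differ, the larger factor \<open>\<bar>x $ j\<bar>\<close> makes its term strictly larger in
    absolute value.\<close>
  then have "\<bar>x $ j\<bar> = t \<or> \<bar>s\<bar> < \<bar>\<bar>x $ j\<bar> * \<mu> (level_pair x \<bar>x $ j\<bar>)\<bar>"
    using t nz pos[of t] by (auto simp: abs_mult)
  then have "\<bar>x $ j\<bar> * \<mu> (level_pair x \<bar>x $ j\<bar>) = s \<or> \<bar>s\<bar> < \<bar>\<bar>x $ j\<bar> * \<mu> (level_pair x \<bar>x $ j\<bar>)\<bar>"
    using t(2) j(2) by auto
  then show "\<exists>r\<in>range (\<lambda>i. \<bar>x $ i\<bar> * \<mu> (level_pair x \<bar>x $ i\<bar>)). r = s \<or> \<bar>s\<bar> < \<bar>r\<bar>"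
    by blast
qed

text \<open>All nonzero components have absolute value \<open>t\<close>, so the single level
  \<open>t\<close> suffices.\<close>

lemma bipolar_shilkret_indicator:
  assumes "\<mu> ({}, {}) = 0" "P \<in> disjoint_pairs" "t > 0"
  shows "bipolar_shilkret (t *\<^sub>R bipolar_indicator P) \<mu> = t * \<mu> P"
proof -
  have "bipolar_shilkret (t *\<^sub>R bipolar_indicator P) \<mu> =
      bipolar_max ((\<lambda>s. s * \<mu> (level_pair (t *\<^sub>R bipolar_indicator P) s)) ` {t})"
    using assms by (intro bipolar_shilkret_levels)
      (auto simp: bipolar_indicator_def abs_mult split: if_splits)
  then show ?thesis using assms by (simp add: level_pair_indicator)
qed

lemma bipolar_shilkret_0: "bipolar_shilkret 0 \<mu> = 0"
  by (simp add: bipolar_shilkret_def image_def)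

text \<open>Scaling by \<open>c\<close> turns each level \<open>t\<close> into \<open>c * t\<close>
  with the same level pair, so every term is multiplied by \<open>c\<close>.\<close>

lemma bipolar_shilkret_scale:
  assumes "c > 0"
  shows "bipolar_shilkret (c *\<^sub>R x) \<mu> = c * bipolar_shilkret x \<mu>"
  using assms unfolding bipolar_shilkret_def
  by (subst bipolar_max_scale[symmetric])
    (simp_all add: image_image abs_mult level_pair_scale mult.assoc)

text \<open>Reduces idempotence of the integral to the normalization of a bi-capacity at
  \<open>(UNIV, {})\<close> and \<open>({}, UNIV)\<close>.\<close>

lemma vec_eq_scaled_indicator:
  "a > 0 \<Longrightarrow> vec a = a *\<^sub>R bipolar_indicator (UNIV, {})"
  "a < 0 \<Longrightarrow> vec a = (- a) *\<^sub>R bipolar_indicator ({}, UNIV)"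
  by (simp_all add: vec_eq_iff bipolar_indicator_def)

lemma bipolar_shilkret_vec:
  assumes "bi_capacity \<mu>"
  shows "bipolar_shilkret (vec a) \<mu> = a"
proof -
  consider "a = 0" | "a > 0" | "a < 0" by linarith
  then show ?thesis
  proof cases
    case 1
    then have "(vec a :: real ^ 'n) = 0" by (simp add: vec_eq_iff)
    with 1 show ?thesis by (simp add: bipolar_shilkret_0)
  qed (use assms in \<open>simp_all only: vec_eq_scaled_indicator, simp_all add: bi_capacity_def
      bipolar_shilkret_indicator disjoint_pairs_def del: scaleR_minus_left\<close>)
qed

section \<open>Vectors as bipolar maxima of scaled indicators\<close>

lemma scaled_indicator_in_cube:
  assumes "0 \<le> t" "t \<le> 1"
  shows "t *\<^sub>R bipolar_indicator P \<in> bipolar_cube"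
  using assms by (auto simp: bipolar_cube_def bipolar_indicator_def)

text \<open>In component \<open>j\<close>, a level \<open>l i \<le> \<bar>x $ j\<bar>\<close>
  contributes \<open>l i\<close> with the sign of \<open>x $ j\<close>, and a higher level
  contributes 0. The level equal to \<open>\<bar>x $ j\<bar>\<close> contributes
  \<open>x $ j\<close> itself and beats the lower ones.\<close>

lemma bipolar_max_vec_level_pairs:
  assumes pos: "\<And>i. i \<in> I \<Longrightarrow> 0 < l i" and cover: "\<And>j. x $ j \<noteq> 0 \<Longrightarrow> \<bar>x $ j\<bar> \<in> l ` I"
  shows "bipolar_max_vec ((\<lambda>i. l i *\<^sub>R bipolar_indicator (level_pair x (l i))) ` I) = x"
proof -
  have "bipolar_max ((\<lambda>i. (l i *\<^sub>R bipolar_indicator (level_pair x (l i))) $ j) ` I) = bipolar_max {x $ j}"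
    for j
  proof (rule bipolar_max_cong)
    fix s assume "s \<in> (\<lambda>i. (l i *\<^sub>R bipolar_indicator (level_pair x (l i))) $ j) ` I" "s \<noteq> 0"
    then obtain i where "i \<in> I" "s = (l i *\<^sub>R bipolar_indicator (level_pair x (l i))) $ j" by blast
    with \<open>s \<noteq> 0\<close> pos[of i] have "x $ j = s \<or> \<bar>s\<bar> < \<bar>x $ j\<bar>"
      by (auto simp: bipolar_indicator_def level_pair_def split: if_splits)
    then show "\<exists>t\<in>{x $ j}. t = s \<or> \<bar>s\<bar> < \<bar>t\<bar>" by simp
  next
    fix t assume "t \<in> {x $ j}" "t \<noteq> 0"
    then obtain i where i: "i \<in> I" "\<bar>x $ j\<bar> = l i" and t: "t = x $ j" using cover[of j] by auto
    have "(l i *\<^sub>R bipolar_indicator (level_pair x (l i))) $ j = t"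
      using i t pos[of i] by (auto simp: bipolar_indicator_def level_pair_def)
    then show "\<exists>s\<in>(\<lambda>i. (l i *\<^sub>R bipolar_indicator (level_pair x (l i))) $ j) ` I. s = t \<or> \<bar>t\<bar> < \<bar>s\<bar>"
      using i by blast
  qed
  then show ?thesis by (simp add: bipolar_max_vec_def image_image vec_eq_iff)
qed

text \<open>Since the levels increase, the last pair containing \<open>j\<close> decides sign and
  size of component \<open>j\<close>. Since the pairs shrink, \<open>j\<close> lies on the same side
  of all earlier pairs, so cutting \<open>y\<close> at \<open>l i\<close> recovers
  \<open>P i\<close>.\<close>

lemma bipolar_max_vec_nested:
  fixes k :: nat and l :: "nat \<Rightarrow> real" and P :: "nat \<Rightarrow> 'n::finite set \<times> 'n set"
  defines "y \<equiv> bipolar_max_vec ((\<lambda>i. l i *\<^sub>R bipolar_indicator (P i)) ` {1..k})"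
  assumes pos: "\<And>i. i \<in> {1..k} \<Longrightarrow> 0 < l i" and mono: "strict_mono_on {1..k} l"
    and disj: "\<And>i. i \<in> {1..k} \<Longrightarrow> P i \<in> disjoint_pairs"
    and nested: "\<And>i j. 1 \<le> i \<Longrightarrow> i \<le> j \<Longrightarrow> j \<le> k \<Longrightarrow> pair_subset (P j) (P i)"
  shows "y $ j \<noteq> 0 \<Longrightarrow> \<bar>y $ j\<bar> \<in> l ` {1..k}"
    and "i \<in> {1..k} \<Longrightarrow> level_pair y (l i) = P i"
proof -
  have char: "(y $ j = 0 \<and> (\<forall>i\<in>{1..k}. j \<notin> fst (P i) \<and> j \<notin> snd (P i))) \<or>
      (\<exists>m\<in>{1..k}. (\<forall>i\<in>{1..k}. j \<in> fst (P i) \<union> snd (P i) \<longrightarrow> i \<le> m) \<and>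
        (j \<in> fst (P m) \<and> y $ j = l m \<or> j \<in> snd (P m) \<and> y $ j = - l m))" for j
  proof (cases "\<exists>i\<in>{1..k}. j \<in> fst (P i) \<union> snd (P i)")
    case False
    then have "y $ j = bipolar_max ((\<lambda>i. 0) ` {1..k})"
      by (auto simp: y_def bipolar_max_vec_def image_image bipolar_indicator_def
          intro!: arg_cong[of _ _ bipolar_max] image_cong)
    \<comment> \<open>For \<open>k = 0\<close> the image is empty rather than \<open>{0}\<close>;
      the congruence covers both cases because it disregards 0.\<close>
    also have "\<dots> = bipolar_max {0}" by (rule bipolar_max_cong) auto
    finally show ?thesis using False by auto
  next
    case True
    define I where "I = {i \<in> {1..k}. j \<in> fst (P i) \<union> snd (P i)}"
    define m where "m = Max I"
    have "finite I" "I \<noteq> {}" using True by (auto simp: I_def)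
    then have m: "m \<in> I" "\<And>i. i \<in> I \<Longrightarrow> i \<le> m" by (auto simp: m_def)
    then have mk: "m \<in> {1..k}" by (simp add: I_def)
    let ?c = "\<lambda>i. (l i *\<^sub>R bipolar_indicator (P i)) $ j"
    have abs_m: "\<bar>?c m\<bar> = l m" using m pos[OF mk] by (auto simp: I_def bipolar_indicator_def)
    \<comment> \<open>Other indices in \<open>I\<close> are smaller than \<open>m\<close> and so
      have smaller levels; indices outside \<open>I\<close> contribute 0.\<close>
    have "strictly_dominant (?c ` {1..k}) (?c m)"
      unfolding strictly_dominant_def
    proof (intro conjI ballI impI)
      show "?c m \<in> ?c ` {1..k}" using mk by blast
      fix z assume "z \<in> ?c ` {1..k}" "z \<noteq> ?c m"
      then obtain i where i: "i \<in> {1..k}" "z = ?c i" "i \<noteq> m" by blast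
      show "\<bar>z\<bar> < \<bar>?c m\<bar>"
      proof (cases "i \<in> I")
        case True
        then have "l i < l m" using m(2)[of i] i mk mono by (auto simp: strict_mono_on_def)
        then show ?thesis using i pos[of i] by (subst abs_m) (auto simp: bipolar_indicator_def)
      next
        case False
        then show ?thesis using i pos[OF mk] by (subst abs_m) (auto simp: bipolar_indicator_def I_def)
      qed
    qed
    then have "y $ j = ?c m"
      using bipolar_max_eq by (simp add: y_def bipolar_max_vec_def image_image)
    then have "j \<in> fst (P m) \<and> y $ j = l m \<or> j \<in> snd (P m) \<and> y $ j = - l m"
      using m(1) by (auto simp: I_def bipolar_indicator_def)
    moreover have "\<forall>i\<in>{1..k}. j \<in> fst (P i) \<union> snd (P i) \<longrightarrow> i \<le> m" using m(2) by (auto simp: I_def)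
    ultimately show ?thesis using mk by blast
  qed
  show "y $ j \<noteq> 0 \<Longrightarrow> \<bar>y $ j\<bar> \<in> l ` {1..k}" for j
    using char[of j] pos by force
  show "level_pair y (l i) = P i" if i: "i \<in> {1..k}"
  proof -
    have li: "l i > 0" using pos i by blast
    have dis: "\<And>j i. i \<in> {1..k} \<Longrightarrow> j \<in> fst (P i) \<Longrightarrow> j \<notin> snd (P i)"
      using disj by (force simp: disjoint_pairs_def)
    have "(y $ j \<ge> l i \<longleftrightarrow> j \<in> fst (P i)) \<and> (y $ j \<le> - l i \<longleftrightarrow> j \<in> snd (P i))" for j
      using char[of j]
    proof (elim disjE bexE conjE)
      assume "y $ j = 0" "\<forall>i\<in>{1..k}. j \<notin> fst (P i) \<and> j \<notin> snd (P i)"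
      then show ?thesis using li i by auto
    next
      fix m assume m: "m \<in> {1..k}" "\<forall>i\<in>{1..k}. j \<in> fst (P i) \<union> snd (P i) \<longrightarrow> i \<le> m"
        "j \<in> fst (P m)" "y $ j = l m"
      \<comment> \<open>Comparing levels amounts to comparing indices. That \<open>i \<le> m\<close>
        is equivalent to membership of \<open>j\<close> in the first component of \<open>P i\<close>
        then follows from the maximality of \<open>m\<close> in one direction and from nesting in
        the other.\<close>
      have le: "l i \<le> l m \<longleftrightarrow> i \<le> m" using strict_mono_on_less_eq[OF mono] i m(1) by blast
      have "i \<le> m \<Longrightarrow> j \<in> fst (P i)"
        using m(1,3) i nested[of i m] by (auto simp: pair_subset_def)
      then have "j \<in> fst (P i) \<longleftrightarrow> i \<le> m" "j \<notin> snd (P i)"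
        using m(2) i dis by blast+
      then show ?thesis using le m(4) li pos[OF m(1)] by auto
    next
      fix m assume m: "m \<in> {1..k}" "\<forall>i\<in>{1..k}. j \<in> fst (P i) \<union> snd (P i) \<longrightarrow> i \<le> m"
        "j \<in> snd (P m)" "y $ j = - l m"
      have le: "l i \<le> l m \<longleftrightarrow> i \<le> m" using strict_mono_on_less_eq[OF mono] i m(1) by blast
      have "i \<le> m \<Longrightarrow> j \<in> snd (P i)"
        using m(1,3) i nested[of i m] by (auto simp: pair_subset_def)
      then have "j \<in> snd (P i) \<longleftrightarrow> i \<le> m" "j \<notin> fst (P i)"
        using m(2) i dis by blast+
      then show ?thesis using le m(4) li pos[OF m(1)] by auto
    qed
    then show ?thesis using li by (simp add: level_pair_def)
  qed
qed

lemma in_bipolar_cube_if_levels: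
  assumes "\<And>j. y $ j \<noteq> 0 \<Longrightarrow> \<bar>y $ j\<bar> \<in> L" "\<And>t. t \<in> L \<Longrightarrow> t \<le> 1"
  shows "y \<in> bipolar_cube"
  unfolding bipolar_cube_def
proof (intro CollectI allI)
  fix j
  have "\<bar>y $ j\<bar> \<le> 1" using assms by (cases "y $ j = 0") auto
  then show "- 1 \<le> y $ j \<and> y $ j \<le> 1" by linarith
qed

section \<open>From the integral to bipolar comonotone maxitivity\<close>

text \<open>The nonzero components of the maximum \<open>y\<close> have absolute values among the
  \<open>l i\<close>, so its integral can be taken over these levels. The term at \<open>l i\<close>
  is \<open>l i * \<mu> (P i)\<close>, which is the integral of the single vector with index
  \<open>i\<close>.\<close>

lemma shilkret_bipolar_comonotone_maxitive:
  fixes G :: "real ^ 'n \<Rightarrow> real"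
  assumes \<mu>: "\<mu> ({}, {}) = 0" and G: "\<And>x. x \<in> bipolar_cube \<Longrightarrow> G x = bipolar_shilkret x \<mu>"
  shows "bipolar_comonotone_maxitive G"
  unfolding bipolar_comonotone_maxitive_def
proof (intro allI impI)
  fix k and l :: "nat \<Rightarrow> real" and P :: "nat \<Rightarrow> 'n set \<times> 'n set"
  assume k: "1 \<le> k" and l1: "0 < l 1" and step: "\<forall>i\<in>{1..<k}. l i < l (i + 1)" and lk: "l k \<le> 1"
    and disj: "\<forall>i\<in>{1..k}. P i \<in> disjoint_pairs"
    and sub: "\<forall>i\<in>{1..<k}. pair_subset (P (i + 1)) (P i)"
  \<comment> \<open>The hypotheses compare only neighbouring indices; \<open>less\<close> and
    \<open>nested\<close> extend them to arbitrary ones.\<close>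
  have less: "i < j \<Longrightarrow> 1 \<le> i \<Longrightarrow> j \<le> k \<Longrightarrow> l i < l j" for i j
  proof (induction j rule: less_induct)
    case (less j)
    then obtain j' where j': "j = Suc j'" by (cases j) auto
    then have "l j' < l j" using less.prems step by auto
    moreover have "l i < l j'" if "i \<noteq> j'" using less.IH[of j'] less.prems j' that by simp
    ultimately show ?case by (cases "i = j'") auto
  qed
  have nested: "i \<le> j \<Longrightarrow> 1 \<le> i \<Longrightarrow> j \<le> k \<Longrightarrow> pair_subset (P j) (P i)" for i j
  proof (induction j rule: dec_induct)
    case (step n)
    then have "pair_subset (P (Suc n)) (P n)" using sub by auto
    with step show ?case by (auto simp: pair_subset_def)
  qed (simp add: pair_subset_def)
  have pos: "0 < l i" if "i \<in> {1..k}" for i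
    using less[of 1 i] l1 that by (cases "i = 1") auto
  have le1: "l i \<le> 1" if "i \<in> {1..k}" for i
    using less[of i k] lk that by (cases "i = k") auto
  have mono: "strict_mono_on {1..k} l" using less by (auto simp: strict_mono_on_def)
  define y where "y = bipolar_max_vec ((\<lambda>i. l i *\<^sub>R bipolar_indicator (P i)) ` {1..k})"
  have y: "\<And>j. y $ j \<noteq> 0 \<Longrightarrow> \<bar>y $ j\<bar> \<in> l ` {1..k}" "\<And>i. i \<in> {1..k} \<Longrightarrow> level_pair y (l i) = P i"
    using bipolar_max_vec_nested[of k l P] pos mono disj nested unfolding y_def by blast+
  have "y \<in> bipolar_cube" using in_bipolar_cube_if_levels y(1) le1 by blast
  then have "G y = bipolar_shilkret y \<mu>" by (rule G)
  also have "\<dots> = bipolar_max ((\<lambda>t. t * \<mu> (level_pair y t)) ` l ` {1..k})"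
    using y(1) pos by (intro bipolar_shilkret_levels \<mu>) auto
  also have "(\<lambda>t. t * \<mu> (level_pair y t)) ` l ` {1..k} =
      (\<lambda>i. G (l i *\<^sub>R bipolar_indicator (P i))) ` {1..k}"
    unfolding image_image
  proof (rule image_cong[OF refl])
    fix i assume i: "i \<in> {1..k}"
    have "l i *\<^sub>R bipolar_indicator (P i) \<in> bipolar_cube"
      using pos[OF i] le1[OF i] by (intro scaled_indicator_in_cube) auto
    then show "l i * \<mu> (level_pair y (l i)) = G (l i *\<^sub>R bipolar_indicator (P i))"
      using i disj pos by (simp add: G y(2) bipolar_shilkret_indicator \<mu>)
  qed
  finally show "G (bipolar_max_vec ((\<lambda>i. l i *\<^sub>R bipolar_indicator (P i)) ` {1..k})) =
      bipolar_max ((\<lambda>i. G (l i *\<^sub>R bipolar_indicator (P i))) ` {1..k})"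
    by (simp add: y_def)
qed

section \<open>From the three properties of \<open>G\<close> to the integral\<close>

text \<open>On disjoint pairs \<open>bipolar_le\<close> gives the componentwise order of the
  indicators, so monotonicity is inherited from \<open>G\<close>; the three prescribed values are
  idempotence at 0, 1 and -1.\<close>

lemma indicator_bi_capacity:
  fixes G :: "real ^ 'n \<Rightarrow> real"
  assumes agg: "aggregation_function G" and idem: "idempotent G"
  shows "bi_capacity (\<lambda>P. G (bipolar_indicator P))"
proof -
  have cube: "bipolar_indicator P \<in> bipolar_cube" for P :: "'n set \<times> 'n set"
    using scaled_indicator_in_cube[of 1 P] by simp
  have "bipolar_indicator ({}, {}) = (vec 0 :: real ^ 'n)" "bipolar_indicator (UNIV, {}) = (vec 1 :: real ^ 'n)"
    "bipolar_indicator ({}, UNIV) = (vec (- 1) :: real ^ 'n)"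
    by (simp_all add: bipolar_indicator_def vec_eq_iff)
  moreover have "G (vec 0) = 0" "G (vec 1) = 1" "G (vec (- 1)) = - 1"
    using idem[unfolded idempotent_def, THEN bspec, of 0]
      idem[unfolded idempotent_def, THEN bspec, of 1]
      idem[unfolded idempotent_def, THEN bspec, of "- 1"] by simp_all
  moreover have "G (bipolar_indicator P) \<le> G (bipolar_indicator R)"
    if "P \<in> disjoint_pairs" "R \<in> disjoint_pairs" "bipolar_le P R" for P R
  proof -
    have "bipolar_indicator P $ i \<le> bipolar_indicator R $ i" for i
      using that by (auto simp: bipolar_indicator_def bipolar_le_def disjoint_pairs_def)
    then show ?thesis using agg cube by (simp add: aggregation_function_def)
  qed
  moreover have "G (bipolar_indicator P) \<in> {-1..1}" for P
    using agg cube by (simp add: aggregation_function_def)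
  ultimately show ?thesis unfolding bi_capacity_def by auto
qed

text \<open>Maxitivity splits \<open>G x\<close> over the level vectors of \<open>x\<close>,
  homogeneity extracts each level as a factor, and what remains is the integral taken over the
  nonzero absolute values of the components.\<close>

lemma bipolar_comonotone_maxitive_eq_shilkret:
  fixes G :: "real ^ 'n \<Rightarrow> real"
  assumes G0: "G 0 = 0" and max: "bipolar_comonotone_maxitive G" and hom: "homogeneous G"
    and x: "x \<in> bipolar_cube"
  shows "G x = bipolar_shilkret x (\<lambda>P. G (bipolar_indicator P))"
\<comment> \<open>The zero vector has no positive level, whereas maxitivity speaks of at least
  one.\<close>
proof (cases "x = 0")
  case True
  then show ?thesis using G0 by (simp add: bipolar_shilkret_0)
next
  case False
  define L where "L = (\<lambda>j. \<bar>x $ j\<bar>) ` {j. x $ j \<noteq> 0}"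
  define xs where "xs = sorted_list_of_set L"
  define k where "k = length xs"
  \<comment> \<open>Levels are numbered from 1, list positions from 0; sorting \<open>L\<close>
    without repetition gives strictly increasing levels.\<close>
  define l where "l i = xs ! (i - 1)" for i
  have "L \<noteq> {}" using False by (auto simp: L_def vec_eq_iff)
  have "finite L" by (simp add: L_def)
  then have xs: "set xs = L" "sorted_wrt (<) xs" by (simp_all add: xs_def)
  have lL: "l ` {1..k} = L"
  proof -
    have "{1..k} = Suc ` {0..<k}" by (simp add: atLeastLessThanSuc_atLeastAtMost)
    then have "l ` {1..k} = (!) xs ` {0..<k}" by (simp only: image_image l_def diff_Suc_1)
    also have "\<dots> = set xs" by (auto simp: k_def set_conv_nth)
    finally show ?thesis using xs(1) by simp
  qed
  have L01: "0 < t \<and> t \<le> 1" if "t \<in> L" for t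
    using that x by (auto simp: L_def bipolar_cube_def abs_le_iff minus_le_iff)
  have l01: "0 < l i \<and> l i \<le> 1" if "i \<in> {1..k}" for i
    using that L01 lL by blast
  have k: "1 \<le> k" using \<open>L \<noteq> {}\<close> xs(1) by (cases xs) (auto simp: k_def)
  have step: "l i < l (i + 1)" if "i \<in> {1..<k}" for i
    using that xs(2) by (auto simp: l_def k_def intro: sorted_wrt_nth_less)
  have cover: "\<And>j. x $ j \<noteq> 0 \<Longrightarrow> \<bar>x $ j\<bar> \<in> l ` {1..k}" unfolding lL by (simp add: L_def)
  have "x = bipolar_max_vec ((\<lambda>i. l i *\<^sub>R bipolar_indicator (level_pair x (l i))) ` {1..k})"
    using cover l01 by (intro bipolar_max_vec_level_pairs[symmetric]) blast+
  then have "G x = G (bipolar_max_vec ((\<lambda>i. l i *\<^sub>R bipolar_indicator (level_pair x (l i))) ` {1..k}))"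
    by simp
  also have "\<dots> = bipolar_max ((\<lambda>i. G (l i *\<^sub>R bipolar_indicator (level_pair x (l i)))) ` {1..k})"
  proof (rule max[unfolded bipolar_comonotone_maxitive_def, rule_format])
    fix i assume "i \<in> {1..<k}"
    then show "pair_subset (level_pair x (l (i + 1))) (level_pair x (l i))"
      using l01[of i] step[of i] by (intro level_pair_antimono) auto
  qed (use k l01 step in \<open>auto intro: level_pair_disjoint less_imp_le\<close>)
  also have "(\<lambda>i. G (l i *\<^sub>R bipolar_indicator (level_pair x (l i)))) ` {1..k} =
      (\<lambda>t. t * G (bipolar_indicator (level_pair x t))) ` L"
    unfolding lL[symmetric] image_image
  proof (rule image_cong[OF refl])
    fix i assume i: "i \<in> {1..k}"
    show "G (l i *\<^sub>R bipolar_indicator (level_pair x (l i))) =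
        l i * G (bipolar_indicator (level_pair x (l i)))"
    \<comment> \<open>The indicator is the base point and \<open>l i\<close> the factor;
      \<open>l i \<le> 1\<close> keeps the scaled vector in the cube.\<close>
    proof (rule hom[unfolded homogeneous_def, rule_format])
      show "bipolar_indicator (level_pair x (l i)) \<in> bipolar_cube"
        using scaled_indicator_in_cube[of 1] by simp
    qed (use l01[OF i] in \<open>auto intro: scaled_indicator_in_cube\<close>)
  qed
  also have "bipolar_max \<dots> = bipolar_shilkret x (\<lambda>P. G (bipolar_indicator P))"
  proof (rule bipolar_shilkret_levels[symmetric])
    have "bipolar_indicator ({}, {}) = (0 :: real ^ 'n)"
      by (simp add: bipolar_indicator_def vec_eq_iff)
    then show "G (bipolar_indicator ({}, {})) = 0" using G0 by simp
  qed (use L01 in \<open>auto simp: L_def\<close>)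
  finally show ?thesis .
qed

section \<open>The characterization of the bipolar Shilkret integral\<close>

theorem theorem5:
  fixes G :: "real ^ 'n \<Rightarrow> real"
  assumes "aggregation_function G"
  shows "(idempotent G \<and> bipolar_comonotone_maxitive G \<and> homogeneous G) \<longleftrightarrow>
    (\<exists>\<mu> :: 'n set \<times> 'n set \<Rightarrow> real.
       bi_capacity \<mu> \<and> (\<forall>x \<in> bipolar_cube. G x = bipolar_shilkret x \<mu>))"
proof
  assume *: "idempotent G \<and> bipolar_comonotone_maxitive G \<and> homogeneous G"
  then have "G (vec 0) = 0" unfolding idempotent_def by (metis atLeastAtMost_iff neg_le_0_iff_le zero_le_one)
  then have "G 0 = 0" by simp
  with * show "\<exists>\<mu> :: 'n set \<times> 'n set \<Rightarrow> real.
      bi_capacity \<mu> \<and> (\<forall>x \<in> bipolar_cube. G x = bipolar_shilkret x \<mu>)"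
    using indicator_bi_capacity[OF assms] bipolar_comonotone_maxitive_eq_shilkret by blast
next
  assume "\<exists>\<mu> :: 'n set \<times> 'n set \<Rightarrow> real.
      bi_capacity \<mu> \<and> (\<forall>x \<in> bipolar_cube. G x = bipolar_shilkret x \<mu>)"
  then obtain \<mu> :: "'n set \<times> 'n set \<Rightarrow> real" where \<mu>: "bi_capacity \<mu>"
    and G: "\<And>x. x \<in> bipolar_cube \<Longrightarrow> G x = bipolar_shilkret x \<mu>" by blast
  have "idempotent G"
    by (auto simp: idempotent_def bipolar_cube_def G bipolar_shilkret_vec[OF \<mu>])
  moreover have "homogeneous G"
    by (simp add: homogeneous_def G bipolar_shilkret_scale)
  moreover have "bipolar_comonotone_maxitive G"
    using \<mu> G by (intro shilkret_bipolar_comonotone_maxitive[of \<mu>]) (auto simp: bi_capacity_def)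
  ultimately show "idempotent G \<and> bipolar_comonotone_maxitive G \<and> homogeneous G" by blast
qed

end
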